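(* Let $G$ be a connected graph of order $n\geq 4$ with maximum degree $\Delta(G)$, and let $C(G)$ be its central graph. Then $D'(C(G))\leq \lceil \sqrt{\Delta(G)}\rceil$.
   Context: All graphs are simple, finite, undirected. The central graph $C(G)$ of $G$ has vertex set $V(G)\cup\{w_{u,v}:\{u,v\}\in E(G)\}$ (one new vertex $w_{u,v}$ for each edge of $G$), and edge set consisting of all pairs $\{u,v\}$ with $u\neq v\in V(G)$ and $\{u,v\}\notin E(G)$, together with the edges $\{u,w_{u,v}\}$ and $\{w_{u,v},v\}$ for every $\{u,v\}\in E(G)$ (i.e. each edge of $G$ is subdivided once and all non-adjacent pairs of original vertices are joined). An automorphism $\phi$ of a graph $H$ preserves an edge coloring $f$ (not necessarily proper) if $f(\phi(e))=f(e)$ for all edges $e$. The distinguishing index $D'(H)$ is the least integer $d$ such that $H$ has an edge coloring with $d$ colors preserved only by the identity automorphism. *)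

theory Defs
  imports Complex_Main "HOL-Library.Extended_Nat"
begin

record 'a graph =
  verts :: "'a set"
  edges :: "'a set set"

definition simple_graph :: "'a graph \<Rightarrow> bool" where
  "simple_graph G \<longleftrightarrow>
     finite (verts G) \<and> (\<forall>e\<in>edges G. e \<subseteq> verts G \<and> card e = 2)"

definition connected_graph :: "'a graph \<Rightarrow> bool" where
  "connected_graph G \<longleftrightarrow>
     verts G \<noteq> {} \<and>
     (\<forall>u\<in>verts G. \<forall>v\<in>verts G. (u, v) \<in> {(x, y). {x, y} \<in> edges G}\<^sup>*)"

definition degree :: "'a graph \<Rightarrow> 'a \<Rightarrow> nat" where
  "degree G v = card {e \<in> edges G. v \<in> e}"

definition max_degree :: "'a graph \<Rightarrow> nat" where
  "max_degree G = Max (degree G ` verts G)"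

(* An original vertex v is represented by Inl v, and the new vertex w_{u,v}
   subdividing the edge {u,v} by Inr {u,v}, so that w_{u,v} = w_{v,u}. *)
definition central_graph :: "'a graph \<Rightarrow> ('a + 'a set) graph" where
  "central_graph G =
     \<lparr>verts = Inl ` verts G \<union> Inr ` edges G,
      edges = {{Inl u, Inl v} | u v.
                 u \<in> verts G \<and> v \<in> verts G \<and> u \<noteq> v \<and> {u, v} \<notin> edges G}
            \<union> {{Inl u, Inr {u, v}} | u v. {u, v} \<in> edges G}\<rparr>"

(* Only the values of \<phi> on verts H matter; accordingly, "is the identity" below
   means "fixes every vertex of H". *)
definition automorphism :: "'a graph \<Rightarrow> ('a \<Rightarrow> 'a) \<Rightarrow> bool" where
  "automorphism H \<phi> \<longleftrightarrow>
     bij_betw \<phi> (verts H) (verts H) \<and>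
     (\<forall>u\<in>verts H. \<forall>v\<in>verts H. {u, v} \<in> edges H \<longleftrightarrow> {\<phi> u, \<phi> v} \<in> edges H)"

definition preserves_coloring ::
    "'a graph \<Rightarrow> ('a set \<Rightarrow> nat) \<Rightarrow> ('a \<Rightarrow> 'a) \<Rightarrow> bool" where
  "preserves_coloring H f \<phi> \<longleftrightarrow> (\<forall>e\<in>edges H. f (\<phi> ` e) = f e)"

definition distinguishing_coloring :: "'a graph \<Rightarrow> nat \<Rightarrow> ('a set \<Rightarrow> nat) \<Rightarrow> bool" where
  "distinguishing_coloring H d f \<longleftrightarrow>
     f ` edges H \<subseteq> {..<d} \<and>
     (\<forall>\<phi>. automorphism H \<phi> \<and> preserves_coloring H f \<phi> \<longrightarrow> (\<forall>v\<in>verts H. \<phi> v = v))"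

(* Some graphs (e.g. a single edge) have no distinguishing edge coloring at all;
   the index is then \<infinity>, the infimum of the empty set. Otherwise the infimum is
   attained and is the least number of colors. *)
definition distinguishing_index :: "'a graph \<Rightarrow> enat" where
  "distinguishing_index H = Inf {enat d | d. \<exists>f. distinguishing_coloring H d f}"

end

theory Submission imports Defs begin

text \<open>
  In \<open>C(G)\<close> the original vertices have degree \<open>n - 1 \<ge> 3\<close> and the new ones degree \<open>2\<close>, so every
  automorphism of \<open>C(G)\<close> comes from one of \<open>G\<close>. Colouring the two halves of each subdivided edge
  with \<open>d\<close> colours labels every edge of \<open>G\<close>, read from a given endpoint, by a pair from a set of
  \<open>d\<^sup>2 \<ge> \<Delta>\<close> labels. Take a breadth-first search tree from a vertex \<open>r\<close> of degree \<open>\<Delta>\<close> and give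
  distinct labels to the edges from a vertex to its children; then an automorphism fixing \<open>r\<close> and
  the labels fixes everything, level by level. To single out \<open>r\<close>, let its incident labels form a
  set \<open>S\<close> of size \<open>\<Delta>\<close>, and label non-tree edges by \<open>(1, 1)\<close>. If \<open>\<Delta> < d\<^sup>2\<close>, choose \<open>S\<close> without
  \<open>(1, 1)\<close> and let every other vertex use \<open>(1, 1)\<close> for one of its children. If \<open>\<Delta> = d\<^sup>2\<close>, let every
  other vertex repeat, on an edge to a child, the label it sees on the edge to its parent; a
  childless vertex of degree \<open>\<Delta> \<ge> 4\<close> sees \<open>(1, 1)\<close> repeatedly. In both cases no other vertex sees
  each label of \<open>S\<close> exactly once.
\<close>

section \<open>Neighbourhoods, degrees and automorphisms\<close>

definition neighbours :: "'a graph \<Rightarrow> 'a \<Rightarrow> 'a set" where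
  "neighbours H x = {y \<in> verts H. {x, y} \<in> edges H}"

lemma edge_verts:
  assumes "simple_graph G" "{x, y} \<in> edges G"
  shows "x \<in> verts G" "y \<in> verts G" "x \<noteq> y"
  using assms by (force simp: simple_graph_def)+

lemma in_neighbours_iff:
  assumes "simple_graph G"
  shows "y \<in> neighbours G x \<longleftrightarrow> {x, y} \<in> edges G"
  using edge_verts[OF assms] by (auto simp: neighbours_def)

lemma finite_neighbours: "simple_graph G \<Longrightarrow> finite (neighbours G x)"
  by (simp add: neighbours_def simple_graph_def)

lemma finite_edges:
  assumes "simple_graph G"
  shows "finite (edges G)"
  by (rule finite_subset[of _ "Pow (verts G)"]) (use assms in \<open>auto simp: simple_graph_def\<close>)

lemma degree_eq_card_neighbours:
  assumes "simple_graph G"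
  shows "degree G x = card (neighbours G x)"
proof -
  have "e \<in> (\<lambda>y. {x, y}) ` neighbours G x" if e: "e \<in> edges G" "x \<in> e" for e
  proof -
    have "card e = 2" using assms e by (simp add: simple_graph_def)
    then obtain y where "e = {x, y}"
      using e(2) by (auto simp: card_2_iff)
    then show ?thesis using e(1) by (auto simp: in_neighbours_iff[OF assms])
  qed
  then have "{e \<in> edges G. x \<in> e} = (\<lambda>y. {x, y}) ` neighbours G x"
    by (auto simp: in_neighbours_iff[OF assms])
  moreover have "inj_on (\<lambda>y. {x, y}) (neighbours G x)"
    by (auto simp: inj_on_def doubleton_eq_iff)
  ultimately show ?thesis by (simp add: degree_def card_image)
qed

lemma degree_le_max_degree:
  assumes "simple_graph G" "x \<in> verts G"
  shows "degree G x \<le> max_degree G"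
  using assms by (simp add: max_degree_def simple_graph_def)

lemma ex_max_degree:
  assumes "simple_graph G" "verts G \<noteq> {}"
  obtains r where "r \<in> verts G" "degree G r = max_degree G"
proof -
  have "max_degree G \<in> degree G ` verts G"
    unfolding max_degree_def using assms by (intro Max_in) (auto simp: simple_graph_def)
  then show thesis using that by auto
qed

text \<open>If every degree were at most 1, the walks from a vertex \<open>r\<close> would stay
  inside \<open>r\<close> and its single neighbour, so connectedness would allow only two vertices.
  The bound later rules out \<open>d = 1\<close>, which makes (1, 1) an admissible label.\<close>

lemma max_degree_ge_2:
  assumes G: "simple_graph G" and con: "connected_graph G" and n: "card (verts G) \<ge> 3"
  shows "max_degree G \<ge> 2"
proof (rule ccontr)
  assume "\<not> ?thesis"
  then have le1: "card (neighbours G x) \<le> 1" if "x \<in> verts G" for x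
    using degree_le_max_degree[OF G that] degree_eq_card_neighbours[OF G, of x] by simp
  obtain r where r: "r \<in> verts G" using con by (auto simp: connected_graph_def)
  have uniq: "y = z" if "{x, y} \<in> edges G" "{x, z} \<in> edges G" for x y z
    using le1[OF edge_verts(1)[OF G that(1)]] that finite_neighbours[OF G, of x]
    by (metis card_le_Suc0_iff_eq in_neighbours_iff[OF G] One_nat_def)
  have "x \<in> insert r (neighbours G r)"
    if "(r, x) \<in> {(x, y). {x, y} \<in> edges G}\<^sup>*" for x
    using that
  proof (induction rule: rtrancl_induct)
    case (step y z)
    then show ?case
      using uniq[of y z r] by (auto simp: in_neighbours_iff[OF G] insert_commute)
  qed simp
  then have "verts G \<subseteq> insert r (neighbours G r)"
    using con r unfolding connected_graph_def by blast
  then have "card (verts G) \<le> card (insert r (neighbours G r))"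
    using finite_neighbours[OF G] by (intro card_mono) auto
  also have "\<dots> \<le> 2" using le1[OF r] card_insert_le_m1[of 2 "neighbours G r" r] by simp
  finally show False using n by simp
qed

lemma automorphism_neighbours:
  assumes "automorphism H \<phi>" "x \<in> verts H"
  shows "neighbours H (\<phi> x) = \<phi> ` neighbours H x"
proof
  show "neighbours H (\<phi> x) \<subseteq> \<phi> ` neighbours H x"
  proof
    fix y assume y: "y \<in> neighbours H (\<phi> x)"
    have "verts H = \<phi> ` verts H"
      using assms(1) by (simp add: automorphism_def bij_betw_def)
    then obtain z where "z \<in> verts H" "y = \<phi> z"
      using y unfolding neighbours_def by blast
    then show "y \<in> \<phi> ` neighbours H x"
      using y assms by (auto simp: automorphism_def neighbours_def)
  qed
qed (use assms in \<open>auto simp: automorphism_def neighbours_def bij_betw_def\<close>)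

lemma automorphism_card_neighbours:
  assumes "automorphism H \<phi>" "x \<in> verts H"
  shows "card (neighbours H (\<phi> x)) = card (neighbours H x)"
proof -
  have "inj_on \<phi> (neighbours H x)"
    using assms by (auto simp: automorphism_def bij_betw_def neighbours_def intro: inj_on_subset)
  then show ?thesis by (simp add: automorphism_neighbours[OF assms] card_image)
qed

subsection \<open>Automorphisms of the central graph\<close>

lemma central_edge_Inl_Inl:
  "{Inl u, Inl v} \<in> edges (central_graph G) \<longleftrightarrow>
    u \<in> verts G \<and> v \<in> verts G \<and> u \<noteq> v \<and> {u, v} \<notin> edges G"
  by (auto simp: central_graph_def doubleton_eq_iff insert_commute)

lemma central_edge_Inl_Inr:
  assumes "simple_graph G"
  shows "{Inl u, Inr e} \<in> edges (central_graph G) \<longleftrightarrow> e \<in> edges G \<and> u \<in> e"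
proof
  assume e: "e \<in> edges G \<and> u \<in> e"
  then have "card e = 2" using assms by (simp add: simple_graph_def)
  then obtain v where "e = {u, v}" using e by (auto simp: card_2_iff)
  then show "{Inl u, Inr e} \<in> edges (central_graph G)"
    using e by (auto simp: central_graph_def)
qed (auto simp: central_graph_def doubleton_eq_iff)

lemma central_edge_Inr_Inr: "{Inr e, Inr e'} \<notin> edges (central_graph G)"
  by (auto simp: central_graph_def doubleton_eq_iff)

lemma finite_central:
  assumes "simple_graph G"
  shows "finite (verts (central_graph G))"
  using assms finite_edges[OF assms] by (simp add: central_graph_def simple_graph_def)

lemma verts_central [simp]: "verts (central_graph G) = Inl ` verts G \<union> Inr ` edges G"
  by (simp add: central_graph_def)

lemma card_neighbours_Inr:
  assumes "simple_graph G" "e \<in> edges G"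
  shows "card (neighbours (central_graph G) (Inr e)) = 2"
proof -
  have sub: "e \<subseteq> verts G" and c: "card e = 2"
    using assms by (auto simp: simple_graph_def)
  have "neighbours (central_graph G) (Inr e) = Inl ` e"
    using sub assms(2) central_edge_Inl_Inr[OF assms(1)] central_edge_Inr_Inr[of e _ G]
    by (auto simp: neighbours_def insert_commute)
  then show ?thesis using c by (simp add: card_image)
qed

lemma card_neighbours_Inl:
  assumes G: "simple_graph G" and u: "u \<in> verts G"
  shows "card (verts G) - 1 \<le> card (neighbours (central_graph G) (Inl u))"
proof -
  \<comment> \<open>Every other vertex \<open>v\<close> yields one neighbour of \<open>u\<close> in
    C(G): \<open>v\<close> itself if the two are not adjacent, and the subdividing vertex of
    \<open>uv\<close> if they are.\<close>
  define g :: "'a \<Rightarrow> 'a + 'a set" where "g v = (if {u, v} \<in> edges G then Inr {u, v} else Inl v)" for v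
  have "inj_on g (verts G - {u})"
    by (auto simp: inj_on_def g_def doubleton_eq_iff split: if_splits)
  moreover have "g ` (verts G - {u}) \<subseteq> neighbours (central_graph G) (Inl u)"
    using u central_edge_Inl_Inl[of u _ G] central_edge_Inl_Inr[OF G]
    by (auto simp: g_def neighbours_def)
  moreover have "finite (neighbours (central_graph G) (Inl u))"
    using finite_central[OF G] by (simp add: neighbours_def)
  ultimately have "card (verts G - {u}) \<le> card (neighbours (central_graph G) (Inl u))"
    by (metis card_inj_on_le)
  then show ?thesis using u by simp
qed

text \<open>Degree 2 against degree at least 3 prevents \<open>\<phi>\<close> from mixing the two
  kinds of vertices. Its restriction \<open>\<psi>\<close> to the original vertices then determines
  the rest, because a subdividing vertex is known from its two ends.\<close>

lemma central_automorphism: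
  fixes G :: "'a graph"
  assumes G: "simple_graph G" and n: "card (verts G) \<ge> 4"
    and \<phi>: "automorphism (central_graph G) \<phi>"
  obtains \<psi> where "automorphism G \<psi>"
    "\<And>u. u \<in> verts G \<Longrightarrow> \<phi> (Inl u) = Inl (\<psi> u)"
    "\<And>e. e \<in> edges G \<Longrightarrow> \<phi> (Inr e) = Inr (\<psi> ` e)"
proof -
  let ?C = "central_graph G"
  have bij: "bij_betw \<phi> (verts ?C) (verts ?C)" using \<phi> by (simp add: automorphism_def)
  have inv: "{\<phi> x, \<phi> y} \<in> edges ?C \<longleftrightarrow> {x, y} \<in> edges ?C"
    if "x \<in> verts ?C" "y \<in> verts ?C" for x y
    using \<phi> that by (auto simp: automorphism_def)
  have L: "\<exists>v. \<phi> (Inl u) = Inl v \<and> v \<in> verts G" if u: "u \<in> verts G" for u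
  proof -
    have "\<phi> (Inl u) \<in> verts ?C" using bij u by (auto simp: bij_betw_def)
    moreover have "\<phi> (Inl u) \<noteq> Inr e" if "e \<in> edges G" for e
      using automorphism_card_neighbours[OF \<phi>, of "Inl u"] u card_neighbours_Inl[OF G u] n
        card_neighbours_Inr[OF G that] by auto
    ultimately show ?thesis by auto
  qed
  have R: "\<exists>e'. \<phi> (Inr e) = Inr e' \<and> e' \<in> edges G" if e: "e \<in> edges G" for e
  proof -
    have "\<phi> (Inr e) \<in> verts ?C" using bij e by (auto simp: bij_betw_def)
    moreover have "\<phi> (Inr e) \<noteq> Inl v" if "v \<in> verts G" for v
      using automorphism_card_neighbours[OF \<phi>, of "Inr e"] e card_neighbours_Inl[OF G that] n
        card_neighbours_Inr[OF G e] by auto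
    ultimately show ?thesis by auto
  qed
  obtain \<psi> where \<psi>: "\<And>u. u \<in> verts G \<Longrightarrow> \<phi> (Inl u) = Inl (\<psi> u) \<and> \<psi> u \<in> verts G"
    using L by metis
  have inj: "inj_on \<psi> (verts G)"
  proof (rule inj_onI)
    fix u v assume uv: "u \<in> verts G" "v \<in> verts G" "\<psi> u = \<psi> v"
    then have "\<phi> (Inl u) = \<phi> (Inl v)" using \<psi> by simp
    then have "(Inl u :: 'a + 'a set) = Inl v"
      using inj_onD[OF bij_betw_imp_inj_on[OF bij], of "Inl u" "Inl v"] uv by simp
    then show "u = v" by simp
  qed
  \<comment> \<open>Between distinct original vertices C(G) is the complement of G, so preserving
    its edges amounts to preserving those of G.\<close>
  have edge: "{\<psi> u, \<psi> v} \<in> edges G \<longleftrightarrow> {u, v} \<in> edges G"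
    if uv: "u \<in> verts G" "v \<in> verts G" for u v
  proof (cases "u = v")
    case True
    then show ?thesis using edge_verts(3)[OF G] by blast
  next
    case False
    then have "\<psi> u \<noteq> \<psi> v" using inj uv by (auto simp: inj_on_def)
    then show ?thesis
      using inv[of "Inl u" "Inl v"] uv \<psi> False by (auto simp: central_edge_Inl_Inl)
  qed
  have "\<psi> ` verts G = verts G"
    using G \<psi> inj by (intro endo_inj_surj) (auto simp: simple_graph_def)
  then have "automorphism G \<psi>"
    using inj edge by (auto simp: automorphism_def bij_betw_def)
  moreover have "\<phi> (Inr e) = Inr (\<psi> ` e)" if e: "e \<in> edges G" for e
  proof -
    obtain e' where e': "\<phi> (Inr e) = Inr e'" "e' \<in> edges G" using R[OF e] by blast
    have card: "card e = 2" "card e' = 2" and sub: "e \<subseteq> verts G"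
      using G e e'(2) by (auto simp: simple_graph_def)
    \<comment> \<open>Incidence in C(G) puts the images of both ends of \<open>e\<close> into
      \<open>e'\<close>; as both sets have two elements, they coincide.\<close>
    have "\<psi> u \<in> e'" if "u \<in> e" for u
    proof -
      have u: "u \<in> verts G" using sub that by auto
      have "{Inl u, Inr e} \<in> edges ?C" using that e central_edge_Inl_Inr[OF G] by blast
      then have "{Inl (\<psi> u), Inr e'} \<in> edges ?C"
        using inv[of "Inl u" "Inr e"] u e \<psi>[OF u] e' by auto
      then show ?thesis using central_edge_Inl_Inr[OF G] by blast
    qed
    moreover have "card (\<psi> ` e) = 2"
      using card(1) inj sub by (metis card_image inj_on_subset)
    ultimately have "\<psi> ` e = e'"
      using card(2) by (metis card_subset_eq card.infinite image_subsetI zero_neq_numeral)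
    then show ?thesis using e' by simp
  qed
  ultimately show thesis using that \<psi> by blast
qed

text \<open>The arc \<open>(u, v)\<close> of \<open>G\<close> stands for the half-edge of \<open>C(G)\<close> at \<open>u\<close> on the subdivided
  edge \<open>uv\<close>.\<close>

lemma distinguishing_coloring_of_arc_coloring:
  fixes G :: "'a graph" and c :: "'a \<Rightarrow> 'a \<Rightarrow> nat"
  assumes G: "simple_graph G" and n: "card (verts G) \<ge> 4" and d: "0 < d"
    and c: "\<And>u v. {u, v} \<in> edges G \<Longrightarrow> c u v < d"
    and fixed: "\<And>\<psi> v. \<lbrakk>automorphism G \<psi>; \<And>u v. {u, v} \<in> edges G \<Longrightarrow> c (\<psi> u) (\<psi> v) = c u v;
      v \<in> verts G\<rbrakk> \<Longrightarrow> \<psi> v = v"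
  shows "\<exists>f. distinguishing_coloring (central_graph G) d f"
proof -
  let ?C = "central_graph G"
  \<comment> \<open>A half-edge determines its arc: its original end is \<open>u\<close>, and
    \<open>v\<close> is the other element of the subdivided edge, so the choice is unambiguous.
    Edges between original vertices get colour 0, legal because \<open>0 < d\<close>.\<close>
  define f :: "('a + 'a set) set \<Rightarrow> nat" where
    "f e = (if \<exists>u v. e = {Inl u, Inr {u, v}}
            then SOME k. \<exists>u v. e = {Inl u, Inr {u, v}} \<and> k = c u v else 0)" for e
  have f: "f {Inl u, Inr {u, v}} = c u v" for u v
  proof -
    have "(SOME k. \<exists>u' v'. {Inl u, Inr {u, v}} = {Inl u', Inr {u', v'}} \<and> k = c u' v') = c u v"
      by (rule some_equality) (auto simp: doubleton_eq_iff)
    then show ?thesis unfolding f_def by auto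
  qed
  have f0: "f {Inl u, Inl v} = 0" for u v
    by (auto simp: f_def doubleton_eq_iff)
  have "f e < d" if "e \<in> edges ?C" for e
    using that f f0 c d by (auto simp: central_graph_def)
  moreover have "\<phi> x = x"
    if \<phi>: "automorphism ?C \<phi>" and pres: "preserves_coloring ?C f \<phi>" and x: "x \<in> verts ?C" for \<phi> x
  proof -
    obtain \<psi> where \<psi>: "automorphism G \<psi>"
      and l: "\<And>u. u \<in> verts G \<Longrightarrow> \<phi> (Inl u) = Inl (\<psi> u)"
      and r: "\<And>e. e \<in> edges G \<Longrightarrow> \<phi> (Inr e) = Inr (\<psi> ` e)"
      using central_automorphism[OF G n \<phi>] by blast
    have "c (\<psi> u) (\<psi> v) = c u v" if uv: "{u, v} \<in> edges G" for u v
    proof -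
      have "{Inl u, Inr {u, v}} \<in> edges ?C"
        using uv central_edge_Inl_Inr[OF G] by blast
      then have "f (\<phi> ` {Inl u, Inr {u, v}}) = f {Inl u, Inr {u, v}}"
        using pres unfolding preserves_coloring_def by blast
      moreover have "\<phi> ` {Inl u, Inr {u, v}} = {Inl (\<psi> u), Inr {\<psi> u, \<psi> v}}"
        using l[of u] r[OF uv] edge_verts[OF G uv] by simp
      ultimately show ?thesis by (simp only: f)
    qed
    then have id: "\<psi> v = v" if "v \<in> verts G" for v using fixed[OF \<psi>] that by blast
    have "\<psi> ` e = e" if "e \<in> edges G" for e
      using that G id by (force simp: simple_graph_def image_iff)
    then show ?thesis using x id l r by auto
  qed
  ultimately show ?thesis unfolding distinguishing_coloring_def by blast
qed

subsection \<open>Breadth-first search trees\<close>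

locale rooted_graph =
  fixes G :: "'a graph" and r :: 'a
  assumes simple: "simple_graph G" and connected: "connected_graph G" and root: "r \<in> verts G"
begin

definition adj :: "('a \<times> 'a) set" where "adj = {(x, y). {x, y} \<in> edges G}"

definition dist :: "'a \<Rightarrow> nat" where "dist y = (LEAST k. (r, y) \<in> adj ^^ k)"

lemma dist_relpow:
  assumes "y \<in> verts G"
  shows "(r, y) \<in> adj ^^ dist y"
proof -
  have "(r, y) \<in> adj\<^sup>*" using connected assms root by (simp add: connected_graph_def adj_def)
  then obtain k where "(r, y) \<in> adj ^^ k" using rtrancl_imp_relpow by fast
  then show ?thesis unfolding dist_def by (rule LeastI)
qed

lemma dist_root [simp]: "dist r = 0"
  by (simp add: dist_def)

lemma dist_eq_0_iff: "y \<in> verts G \<Longrightarrow> dist y = 0 \<longleftrightarrow> y = r"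
  using dist_relpow[of y] by auto

lemma dist_le: "(r, y) \<in> adj ^^ k \<Longrightarrow> dist y \<le> k"
  unfolding dist_def by (rule Least_le)

lemma dist_edge:
  assumes "{x, y} \<in> edges G"
  shows "dist y \<le> Suc (dist x)"
proof (rule dist_le)
  show "(r, y) \<in> adj ^^ Suc (dist x)"
    using dist_relpow[OF edge_verts(1)[OF simple assms]] assms by (auto simp: adj_def)
qed

text \<open>The parent depends only on the set of neighbours one level up. This is why an automorphism
  fixing all vertices of a level preserves the parents of the vertices of the next one.\<close>

definition upper :: "'a \<Rightarrow> 'a set" where "upper y = {x. {x, y} \<in> edges G \<and> Suc (dist x) = dist y}"

definition parent :: "'a \<Rightarrow> 'a" where "parent y = (SOME x. x \<in> upper y)"

definition children :: "'a \<Rightarrow> 'a set" where "children x = {y \<in> verts G - {r}. parent y = x}"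

lemma parent_upper:
  assumes "y \<in> verts G" "y \<noteq> r"
  shows "parent y \<in> upper y"
proof -
  obtain k where k: "dist y = Suc k" using assms dist_eq_0_iff not0_implies_Suc by blast
  then obtain x where x: "(r, x) \<in> adj ^^ k" "{x, y} \<in> edges G"
    using dist_relpow[OF assms(1)] by (auto simp: adj_def)
  have "dist x = k" using dist_le[OF x(1)] dist_edge[OF x(2)] k by simp
  then have "x \<in> upper y" using x k by (simp add: upper_def)
  then show ?thesis unfolding parent_def by (rule someI)
qed

lemma parent_edge: "\<lbrakk>y \<in> verts G; y \<noteq> r\<rbrakk> \<Longrightarrow> {parent y, y} \<in> edges G"
  and dist_parent: "\<lbrakk>y \<in> verts G; y \<noteq> r\<rbrakk> \<Longrightarrow> dist y = Suc (dist (parent y))"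
  using parent_upper by (simp_all add: upper_def)

lemma children_subset: "children x \<subseteq> neighbours G x"
  using parent_edge by (auto simp: children_def neighbours_def)

lemma finite_children: "finite (children x)"
  using children_subset finite_neighbours[OF simple] finite_subset by blast

text \<open>A neighbour of the root lies on level 1, and the root is alone on level 0. Hence the
  labels seen from the root all come from tree edges.\<close>

lemma children_root: "children r = neighbours G r"
proof
  show "neighbours G r \<subseteq> children r"
  proof
    fix y assume "y \<in> neighbours G r"
    then have e: "{r, y} \<in> edges G" by (simp add: neighbours_def)
    note y = edge_verts[OF simple e]
    have "dist (parent y) = 0"
      using dist_edge[OF e] dist_parent[of y] y by auto
    then have "parent y = r"
      using dist_eq_0_iff edge_verts(1)[OF simple parent_edge[of y]] y by auto
    then show "y \<in> children r" using y by (auto simp: children_def)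
  qed
qed (rule children_subset)

lemma card_children:
  assumes "x \<in> verts G" "x \<noteq> r"
  shows "card (children x) < card (neighbours G x)"
proof (rule psubset_card_mono[OF finite_neighbours[OF simple]])
  have "parent x \<in> neighbours G x"
    using parent_edge[OF assms] by (simp add: in_neighbours_iff[OF simple] insert_commute)
  moreover have "parent x \<notin> children x"
    using dist_parent[OF assms] dist_parent[of "parent x"] by (auto simp: children_def)
  ultimately show "children x \<subset> neighbours G x" using children_subset by blast
qed

text \<open>Induction on levels: once all smaller levels are fixed, \<open>y\<close> and its image
  have the same parent, and the labels at that parent tell its children apart.\<close>

lemma fixed_of_root_fixed:
  assumes \<psi>: "automorphism G \<psi>" and "\<psi> r = r"
    and inj: "\<And>x. x \<in> verts G \<Longrightarrow> inj_on (l x) (children x)"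
    and l: "\<And>x y. {x, y} \<in> edges G \<Longrightarrow> l (\<psi> x) (\<psi> y) = l x y"
    and "y \<in> verts G"
  shows "\<psi> y = y"
  using \<open>y \<in> verts G\<close>
proof (induction "dist y" arbitrary: y rule: less_induct)
  case less
  show ?case
  proof (cases "y = r")
    case False
    let ?x = "parent y"
    have bij: "bij_betw \<psi> (verts G) (verts G)"
      and inv: "\<And>u v. u \<in> verts G \<Longrightarrow> v \<in> verts G \<Longrightarrow>
        {\<psi> u, \<psi> v} \<in> edges G \<longleftrightarrow> {u, v} \<in> edges G"
      using \<psi> by (auto simp: automorphism_def)
    have y': "\<psi> y \<in> verts G" using bij less.prems by (auto simp: bij_betw_def)
    have e: "{?x, y} \<in> edges G" using parent_edge less.prems False by blast
    have x: "?x \<in> verts G" using edge_verts[OF simple e] by blast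
    have dy: "dist y = Suc (dist ?x)" using dist_parent less.prems False by blast
    then have fx: "\<psi> ?x = ?x" using less.hyps x by simp
    then have e': "{?x, \<psi> y} \<in> edges G" using inv[OF x less.prems] e by simp
    \<comment> \<open>The image is adjacent to the fixed parent, so it cannot lie deeper than
      \<open>y\<close>. If it lay higher, it would itself be fixed, and injectivity would give
      \<open>\<psi> y = y\<close>.\<close>
    have "dist (\<psi> y) = dist y"
    proof (rule ccontr)
      assume "dist (\<psi> y) \<noteq> dist y"
      then have "dist (\<psi> y) < dist y" using dist_edge[OF e'] dy by simp
      then have "\<psi> (\<psi> y) = \<psi> y" using less.hyps y' by blast
      then have "\<psi> y = y" using bij y' less.prems by (auto simp: bij_betw_def inj_on_def)
      then show False using \<open>dist (\<psi> y) \<noteq> dist y\<close> by simp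
    qed
    moreover have "{u, \<psi> y} \<in> edges G \<longleftrightarrow> {u, y} \<in> edges G"
      if u: "Suc (dist u) = dist y" "u \<in> verts G" for u
    proof -
      have "\<psi> u = u" using less.hyps u by simp
      then show ?thesis using inv[OF u(2) less.prems] by simp
    qed
    ultimately have "upper (\<psi> y) = upper y"
      using edge_verts(1)[OF simple] by (auto simp: upper_def)
    then have "parent (\<psi> y) = ?x" by (simp add: parent_def)
    moreover have "dist (\<psi> y) \<noteq> dist r"
      using \<open>dist (\<psi> y) = dist y\<close> dy by simp
    then have "\<psi> y \<noteq> r" by metis
    ultimately have "\<psi> y \<in> children ?x" "y \<in> children ?x"
      using y' less.prems False by (auto simp: children_def)
    moreover have "l ?x (\<psi> y) = l ?x y" using l[OF e] fx by simp
    ultimately show ?thesis using inj_onD[OF inj[OF x]] by blast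
  qed (use assms in simp)
qed

end

subsection \<open>The arc colouring\<close>

text \<open>Send one element to \<open>q\<close> and inject the others into the rest of
  \<open>D\<close>. This labels the children of a vertex with a prescribed label among them.\<close>

lemma ex_inj_on_hitting:
  assumes "finite A" "finite D" "card A \<le> card D" "q \<in> D"
  shows "\<exists>g. inj_on g A \<and> g ` A \<subseteq> D \<and> (A \<noteq> {} \<longrightarrow> q \<in> g ` A)"
proof (cases "A = {}")
  case False
  then obtain a where a: "a \<in> A" by blast
  have "card (A - {a}) \<le> card (D - {q})" using assms a by simp
  then obtain g where g: "inj_on g (A - {a})" "g ` (A - {a}) \<subseteq> D - {q}"
    using assms by (metis card_le_inj finite_Diff)
  have "inj_on (g(a := q)) A" "(g(a := q)) ` A \<subseteq> D" "q \<in> (g(a := q)) ` A"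
    using g a assms(4) by (auto simp: inj_on_def image_subset_iff)
  then show ?thesis by blast
qed auto

context rooted_graph
begin

text \<open>\<open>L y\<close> labels the edge from the parent of \<open>y\<close> to \<open>y\<close>; \<open>Q (L x)\<close> is the label that \<open>x\<close> must use
  for one of its children.\<close>

lemma ex_tree_labelling:
  fixes D S :: "'b set" and Q :: "'b \<Rightarrow> 'b"
  assumes D: "finite D" "max_degree G \<le> card D" and Q: "Q ` D \<subseteq> D"
    and S: "S \<subseteq> D" "card S = max_degree G" and deg: "degree G r = max_degree G"
  obtains L where "bij_betw L (children r) S"
    and "\<And>y. y \<in> verts G - {r} \<Longrightarrow> L y \<in> D"
    and "\<And>x. x \<in> verts G \<Longrightarrow> inj_on L (children x)"
    and "\<And>x. \<lbrakk>x \<in> verts G - {r}; children x \<noteq> {}\<rbrakk> \<Longrightarrow> Q (L x) \<in> L ` children x"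
proof -
  have finS: "finite S" using D S finite_subset by blast
  have "card (children r) = card S"
    using S deg by (simp add: children_root degree_eq_card_neighbours[OF simple])
  then obtain g where g: "bij_betw g (children r) S"
    using finite_same_card_bij[OF finite_children finS] by blast
  have "\<exists>h. inj_on h (children x) \<and> h ` children x \<subseteq> D \<and> (children x \<noteq> {} \<longrightarrow> q \<in> h ` children x)"
    if "x \<in> verts G - {r}" "q \<in> D" for x q
    using card_children[of x] degree_le_max_degree[OF simple, of x] D that
    by (intro ex_inj_on_hitting finite_children)
      (auto simp: degree_eq_card_neighbours[OF simple])
  then obtain h where h: "\<And>x q. \<lbrakk>x \<in> verts G - {r}; q \<in> D\<rbrakk> \<Longrightarrow>
      inj_on (h x q) (children x) \<and> h x q ` children x \<subseteq> D \<and>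
      (children x \<noteq> {} \<longrightarrow> q \<in> h x q ` children x)"
    by metis
  \<comment> \<open>Recursion on the level: the labels below \<open>x\<close> depend on the label of
    \<open>x\<close> itself. \<open>F k\<close> is meant for vertices of level \<open>k\<close>,
    hence \<open>L\<close> evaluates it at \<open>dist y\<close>.\<close>
  define F where "F = rec_nat g (\<lambda>_ F y. if parent y = r then g y else h (parent y) (Q (F (parent y))) y)"
  define L where "L y = F (dist y) y" for y
  have L_root: "L y = g y" if "y \<in> children r" for y
    using that dist_parent[of y] by (auto simp: L_def F_def children_def)
  have L_step: "L y = h x (Q (L x)) y" if "y \<in> children x" "x \<noteq> r" for x y
    using that dist_parent[of y] by (auto simp: L_def F_def children_def)
  have LD: "L y \<in> D" if "y \<in> verts G - {r}" for y
    using that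
  proof (induction "dist y" arbitrary: y rule: less_induct)
    case less
    let ?x = "parent y"
    have y: "y \<in> children ?x" using less.prems by (simp add: children_def)
    show ?case
    proof (cases "?x = r")
      case True
      then show ?thesis using y L_root[of y] g S by (auto simp: bij_betw_def)
    next
      case False
      have x: "?x \<in> verts G - {r}"
        using False edge_verts(1)[OF simple parent_edge] less.prems by blast
      then have "L ?x \<in> D" using less.hyps[of ?x] dist_parent[of y] less.prems by auto
      then have "Q (L ?x) \<in> D" using Q by blast
      then show ?thesis using h[OF x] L_step[OF y False] y by auto
    qed
  qed
  have good: "inj_on L (children x) \<and> (children x \<noteq> {} \<longrightarrow> Q (L x) \<in> L ` children x)"
    if x: "x \<in> verts G - {r}" for x
  proof -
    have "Q (L x) \<in> D" using Q LD[OF x] by blast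
    moreover have "L y = h x (Q (L x)) y" if "y \<in> children x" for y using L_step that x by blast
    ultimately show ?thesis using h[OF x] by (metis (no_types, lifting) image_cong inj_on_cong)
  qed
  have "bij_betw L (children r) S" using g L_root by (metis bij_betw_cong)
  moreover from this have "inj_on L (children x)" if "x \<in> verts G" for x
    using good that by (cases "x = r") (auto simp: bij_betw_def)
  ultimately show thesis using that LD good by blast
qed

lemma ex_distinguishing_arc_coloring:
  assumes deg: "degree G r = max_degree G" and \<Delta>: "2 \<le> max_degree G" and d: "max_degree G \<le> d * d"
  obtains c :: "'a \<Rightarrow> 'a \<Rightarrow> nat" where "\<And>u v. {u, v} \<in> edges G \<Longrightarrow> c u v < d"
    and "\<And>\<psi> v. \<lbrakk>automorphism G \<psi>; \<And>u v. {u, v} \<in> edges G \<Longrightarrow> c (\<psi> u) (\<psi> v) = c u v;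
      v \<in> verts G\<rbrakk> \<Longrightarrow> \<psi> v = v"
proof -
  define D where "D = {..<d} \<times> {..<d}"
  have d2: "1 < d"
  proof (rule ccontr)
    assume "\<not> 1 < d"
    then have "d * d \<le> 1 * 1" by (intro mult_le_mono) auto
    then show False using \<Delta> d by simp
  qed
  have D: "finite D" "card D = d * d" "(1, 1) \<in> D"
    using d2 by (auto simp: D_def card_cartesian_product)
  \<comment> \<open>\<open>L x\<close> is read from the parent of \<open>x\<close>; read from
    \<open>x\<close>, the same edge carries the swapped pair. So \<open>prod.swap\<close> makes a
    child edge repeat what \<open>x\<close> sees towards its parent.\<close>
  define Q :: "nat \<times> nat \<Rightarrow> nat \<times> nat"
    where "Q = (if max_degree G < d * d then \<lambda>_. (1, 1) else prod.swap)"
  have Q: "Q ` D \<subseteq> D" using D(3) by (auto simp: Q_def D_def)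
  have "\<exists>S. S \<subseteq> D \<and> card S = max_degree G \<and> (max_degree G < d * d \<longrightarrow> (1, 1) \<notin> S)"
  proof (cases "max_degree G < d * d")
    case True
    then have "max_degree G \<le> card (D - {(1, 1)})" using D by simp
    then obtain S where "S \<subseteq> D - {(1, 1)}" "card S = max_degree G"
      by (rule obtain_subset_with_card_n)
    then show ?thesis by blast
  next
    case False
    then show ?thesis using D d by (intro exI[of _ D]) auto
  qed
  then obtain S where S: "S \<subseteq> D" "card S = max_degree G"
    and S11: "max_degree G < d * d \<Longrightarrow> (1, 1) \<notin> S" by blast
  obtain L where Lr: "bij_betw L (children r) S"
    and LD: "\<And>y. y \<in> verts G - {r} \<Longrightarrow> L y \<in> D"
    and Linj: "\<And>x. x \<in> verts G \<Longrightarrow> inj_on L (children x)"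
    and LQ: "\<And>x. \<lbrakk>x \<in> verts G - {r}; children x \<noteq> {}\<rbrakk> \<Longrightarrow> Q (L x) \<in> L ` children x"
    using ex_tree_labelling[of D Q S] D d Q S deg by metis
  \<comment> \<open>On a tree edge the first component of the label colours the half at the parent
    and the second the half at the child. Non-tree edges get the symmetric pair (1, 1).\<close>
  define c where "c x y = (if y \<in> children x then fst (L y)
    else if x \<in> children y then snd (L x) else 1)" for x y
  define lab where "lab x y = (c x y, c y x)" for x y
  have no2: "x \<notin> children y" if "y \<in> children x" for x y
    using that dist_parent[of y] dist_parent[of x] by (auto simp: children_def)
  have lab_child: "lab x y = L y" if "y \<in> children x" for x y
    using that no2[OF that] by (simp add: lab_def c_def)
  have lab_parent: "lab y x = prod.swap (L y)" if "y \<in> children x" for x y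
    using that no2[OF that] by (simp add: lab_def c_def prod.swap_def)
  have lab_other: "lab x y = (1, 1)" if "y \<notin> children x" "x \<notin> children y" for x y
    using that by (simp add: lab_def c_def)
  have "c u v < d" if "{u, v} \<in> edges G" for u v
    using LD[of u] LD[of v] d2 by (auto simp: c_def D_def children_def mem_Times_iff)
  moreover have "\<psi> v = v"
    if \<psi>: "automorphism G \<psi>" and pres: "\<And>u v. {u, v} \<in> edges G \<Longrightarrow> c (\<psi> u) (\<psi> v) = c u v"
      and v: "v \<in> verts G" for \<psi> v
  proof -
    have lab: "lab (\<psi> u) (\<psi> v) = lab u v" if "{u, v} \<in> edges G" for u v
      using pres[OF that] pres[of v u] that by (simp add: lab_def insert_commute)
    define x where "x = \<psi> r"
    have x: "x \<in> verts G" using \<psi> root by (auto simp: x_def automorphism_def bij_betw_def)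
    have nx: "neighbours G x = \<psi> ` neighbours G r"
      unfolding x_def by (rule automorphism_neighbours[OF \<psi> root])
    have cx: "card (neighbours G x) = max_degree G"
      using automorphism_card_neighbours[OF \<psi> root] deg
      by (simp add: x_def degree_eq_card_neighbours[OF simple])
    have "lab x ` neighbours G x = lab r ` neighbours G r"
      unfolding nx image_image unfolding x_def
      by (rule image_cong) (auto simp: lab in_neighbours_iff[OF simple])
    also have "\<dots> = S"
      using Lr lab_child by (simp add: children_root[symmetric] bij_betw_def)
    finally have labS: "lab x ` neighbours G x = S" .
    \<comment> \<open>The image of the root has as many neighbours as \<open>S\<close> has labels,
      so it sees no label twice. Both contradictions below rest on this or on
      \<open>labS\<close>.\<close>
    then have labinj: "inj_on (lab x) (neighbours G x)"
      using cx S by (intro eq_card_imp_inj_on finite_neighbours[OF simple]) simp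
    have "x = r"
    proof (rule ccontr)
      assume "x \<noteq> r"
      let ?p = "parent x"
      have xp: "x \<in> children ?p" using x \<open>x \<noteq> r\<close> by (simp add: children_def)
      have p: "?p \<in> neighbours G x"
        using parent_edge[OF x \<open>x \<noteq> r\<close>] by (simp add: in_neighbours_iff[OF simple] insert_commute)
      have other: "lab x y = (1, 1)" if "children x = {}" "y \<in> neighbours G x - {?p}" for y
        using that by (intro lab_other) (auto simp: children_def)
      have card_other: "card (neighbours G x - {?p}) = max_degree G - 1"
        using p cx by simp
      have child: "\<exists>y. y \<in> children x \<and> y \<in> neighbours G x \<and> lab x y = Q (L x)"
        if "children x \<noteq> {}"
        using LQ[OF _ that] x \<open>x \<noteq> r\<close> lab_child children_subset by force
      show False
      proof (cases "max_degree G < d * d")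
        case True
        have "(1, 1) \<in> lab x ` neighbours G x"
        proof (cases "children x = {}")
          case True
          \<comment> \<open>As the maximum degree is at least 2, a childless \<open>x\<close> has a
            neighbour besides its parent, and the edge to it is not a tree edge.\<close>
          have "card (neighbours G x - {?p}) \<noteq> 0" using card_other \<Delta> by simp
          then have "neighbours G x - {?p} \<noteq> {}" by (metis card.empty)
          then show ?thesis using other[OF True] by (metis DiffD1 ex_in_conv image_eqI)
        next
          case False
          have "Q (L x) = (1, 1)" using True by (simp add: Q_def)
          then show ?thesis using child[OF False] by (metis image_eqI)
        qed
        then show False using S11[OF True] labS by simp
      next
        case eq: False
        show False
        proof (cases "children x = {}")
          case True
          \<comment> \<open>Here the maximum degree is at least 4, so a childless \<open>x\<close>
            has two neighbours besides its parent, both seen with label (1, 1).\<close>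
          have "2 * 2 \<le> d * d" using d2 by (intro mult_le_mono) auto
          then have "2 \<le> card (neighbours G x - {?p})"
            using card_other eq by simp
          then obtain y z where "y \<in> neighbours G x - {?p}" "z \<in> neighbours G x - {?p}" "y \<noteq> z"
            using card_le_Suc0_iff_eq[of "neighbours G x - {?p}"] finite_neighbours[OF simple] by force
          then show False using other[OF True] labinj by (metis DiffD1 inj_onD)
        next
          case False
          then obtain y where y: "y \<in> children x" "y \<in> neighbours G x" "lab x y = prod.swap (L x)"
            using child[OF False] eq by (auto simp: Q_def)
          \<comment> \<open>The child \<open>y\<close> and the parent are seen with the same label,
            so injectivity identifies them; but a parent is never a child of the same
            vertex.\<close>
          then have "y = ?p" using labinj lab_parent[OF xp] p by (metis inj_onD)
          then show False using y(1) no2[OF xp] by simp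
        qed
      qed
    qed
    then have "\<psi> r = r" by (simp add: x_def)
    moreover have "inj_on (lab u) (children u)" if "u \<in> verts G" for u
      using Linj[OF that] lab_child inj_on_cong[of "children u" "lab u" L] by blast
    ultimately show ?thesis
      using lab v by (rule fixed_of_root_fixed[where l = lab, OF \<psi>])
  qed
  ultimately show thesis using that by blast
qed

end

section \<open>The bound for the distinguishing index\<close>

theorem theorem3p2:
  fixes G :: "'a graph" and n :: nat
  assumes "simple_graph G"
    and "connected_graph G"
    and "card (verts G) = n"
    and "n \<ge> 4"
  shows "distinguishing_index (central_graph G) \<le> enat (nat \<lceil>sqrt (real (max_degree G))\<rceil>)"
proof -
  define d where "d = nat \<lceil>sqrt (real (max_degree G))\<rceil>"
  obtain r where r: "r \<in> verts G" "degree G r = max_degree G"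
    using ex_max_degree[OF assms(1)] assms(2) by (auto simp: connected_graph_def)
  interpret rooted_graph G r using assms r by unfold_locales auto
  have \<Delta>: "2 \<le> max_degree G" using max_degree_ge_2[OF assms(1,2)] assms(3,4) by simp
  have "sqrt (real (max_degree G)) \<le> real d" unfolding d_def by linarith
  then have "real (max_degree G) \<le> real d * real d"
    using real_le_lsqrt real_sqrt_le_iff sqrt_le_D by (metis power2_eq_square)
  then have d: "max_degree G \<le> d * d" by (metis of_nat_le_iff of_nat_mult)
  then have "0 < d" using \<Delta> by (cases d) auto
  obtain c :: "'a \<Rightarrow> 'a \<Rightarrow> nat" where c: "\<And>u v. {u, v} \<in> edges G \<Longrightarrow> c u v < d"
    "\<And>\<psi> v. \<lbrakk>automorphism G \<psi>; \<And>u v. {u, v} \<in> edges G \<Longrightarrow> c (\<psi> u) (\<psi> v) = c u v;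
      v \<in> verts G\<rbrakk> \<Longrightarrow> \<psi> v = v"
    using ex_distinguishing_arc_coloring[OF r(2) \<Delta> d] by metis
  have "\<exists>f. distinguishing_coloring (central_graph G) d f"
  proof (rule distinguishing_coloring_of_arc_coloring[where c = c])
    show "card (verts G) \<ge> 4" using assms(3,4) by simp
  qed (fact assms(1) \<open>0 < d\<close> c)+
  then show ?thesis
    unfolding distinguishing_index_def d_def[symmetric] by (intro Inf_lower) auto
qed

end
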